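(* Let $L$ be an infeasible linear pencil in $n$ variables (i.e. $S_L=\emptyset$). Then $$-1\in M_L^{(2^n-1)}.$$
   Context: $\mathbb{R}[X]=\mathbb{R}[X_1,\dots,X_n]$, and $\mathbb{R}[X]_k$ is the space of polynomials of degree at most $k$. A linear pencil of size $m$ in $n$ variables is a symmetric $m\times m$ matrix $L=A_0+\sum_{i=1}^n X_iA_i$ with $A_0,\dots,A_n$ real symmetric $m\times m$ matrices. $A^*$ denotes the transpose, and $A\succeq0$ means that $A$ is real symmetric positive semidefinite. $S_L=\{x\in\mathbb{R}^n\mid L(x)\succeq0\}$; $L$ is infeasible if $S_L=\emptyset$. For an integer $k\ge0$, the truncated quadratic module is $$M_L^{(k)}=\Big\{\sum_i p_i^2+\sum_j v_j^*Lv_j\ \Big|\ p_i\in\mathbb{R}[X]_k,\ v_j\in(\mathbb{R}[X]_k)^m\Big\}\subseteq\mathbb{R}[X]_{2k+1}$$ (all sums finite). *)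

theory Defs
  imports "HOL-Analysis.Analysis" "HOL-Library.Poly_Mapping"
begin

(* A monomial is its finitely supported exponent function; a polynomial maps monomials to
   coefficients. Multiplication of poly_mapping is convolution, i.e. polynomial multiplication. *)
type_synonym rpoly = "(nat \<Rightarrow>\<^sub>0 nat) \<Rightarrow>\<^sub>0 real"

definition Const :: "real \<Rightarrow> rpoly" where
  "Const c = Poly_Mapping.single 0 c"

definition Var :: "nat \<Rightarrow> rpoly" where
  "Var i = Poly_Mapping.single (Poly_Mapping.single i 1) 1"

definition mono_deg :: "(nat \<Rightarrow>\<^sub>0 nat) \<Rightarrow> nat" where
  "mono_deg t = (\<Sum>i\<in>Poly_Mapping.keys t. Poly_Mapping.lookup t i)"

definition eval_poly :: "(nat \<Rightarrow> real) \<Rightarrow> rpoly \<Rightarrow> real" where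
  "eval_poly x p = (\<Sum>t\<in>Poly_Mapping.keys p. Poly_Mapping.lookup p t *
     (\<Prod>i\<in>Poly_Mapping.keys t. x i ^ Poly_Mapping.lookup t i))"

(* Polynomials of total degree at most k in the n variables Var 0, ..., Var (n - 1). *)
definition polys :: "nat \<Rightarrow> nat \<Rightarrow> rpoly set" where
  "polys n k = {p. \<forall>t\<in>Poly_Mapping.keys p. Poly_Mapping.keys t \<subseteq> {..<n} \<and> mono_deg t \<le> k}"

definition linear_pencil :: "nat \<Rightarrow> rpoly ^ 'm ^ 'm \<Rightarrow> bool" where
  "linear_pencil n L \<longleftrightarrow>
     (\<exists>(A0 :: real ^ 'm ^ 'm) (A :: nat \<Rightarrow> real ^ 'm ^ 'm).
        transpose A0 = A0 \<and> (\<forall>i<n. transpose (A i) = A i) \<and>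
        L = (\<chi> j k. Const (A0 $ j $ k) + (\<Sum>i<n. Var i * Const (A i $ j $ k))))"

definition psd :: "real ^ 'm ^ 'm \<Rightarrow> bool" where
  "psd A \<longleftrightarrow> transpose A = A \<and> (\<forall>v. 0 \<le> v \<bullet> (A *v v))"

(* Points of n-dimensional real space are the extensional functions on {..<n}. *)
definition feasible_set :: "nat \<Rightarrow> rpoly ^ 'm ^ 'm \<Rightarrow> (nat \<Rightarrow> real) set" where
  "feasible_set n L = {x \<in> {..<n} \<rightarrow>\<^sub>E UNIV. psd (map_matrix (eval_poly x) L)}"

definition trunc_qmodule :: "nat \<Rightarrow> rpoly ^ 'm ^ 'm \<Rightarrow> nat \<Rightarrow> rpoly set" where
  "trunc_qmodule n L k =
     {(\<Sum>p\<leftarrow>ps. p\<^sup>2) + (\<Sum>v\<leftarrow>vs. scalar_product v (L *v v)) | ps (vs :: (rpoly ^ 'm) list).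
        set ps \<subseteq> polys n k \<and> (\<forall>v\<in>set vs. \<forall>j. v $ j \<in> polys n k)}"

end

theory Submission
  imports Defs
begin

text \<open>The proof is by induction on the number of variables. Either $-1$ has a certificate of degree
zero, or there is an affine polynomial $l \neq 0$ that must vanish on the (empty) feasible set for a
reason that the quadratic module can see: $-l^2$ has a certificate of degree one. In the second case
$l = 0$ is used to eliminate a variable.

The alternative comes from convexity (lemma \<open>infeasible_pencil_null_combination\<close>). Consider the
pencil $L \oplus (1)$ and the convex hull of its rank one test matrices, that is, of the pairs
$(uu^*, c^2)$ with $|u|^2 + c^2 = 1$, where $u$ is restricted to the orthogonal complement of the
common kernel of the coefficient matrices. If this compact set contained no pair orthogonal to all
coefficients of $L \oplus (1)$, a separating hyperplane would be a real point at which $L$ is positive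
semidefinite. So $\sum_i \lambda_i (u_i^* L u_i + c_i^2) = 0$ for some convex combination. If
some $\lambda_i c_i \neq 0$, solving for $-1$ gives a certificate of degree zero. Otherwise fix $i$
with $\lambda_i > 0$, so that $u_i \neq 0$. If $l = u_i^* L u_i$ is nonzero, then both $l$ and $-l$
lie in the quadratic module, and $-4l^2 = (1-l)^2 l - (1+l)^2 l$. If it is zero, then $L u_i \neq 0$
because $u_i$ is orthogonal to the common kernel, so $l = w^* L u_i \neq 0$ for some real $w$, and a
suitable combination of $u_i$ and $w$ over the polynomials represents $-l^2$
(lemmas \<open>minus_square_if_both_signs\<close>, \<open>minus_square_if_isotropic\<close>,
\<open>infeasible_pencil_dichotomy\<close>).

For the elimination, write $L' = L + l D$, where the real matrix $D$ is chosen such that $L'$ involves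
one variable less. Then $L'$ is again infeasible, and a certificate of degree $k$ for $L'$ reads
$-1 = m + l q$ with $m$ in the quadratic module of $L$ and $\deg q \le 2k$. Now
$-1 = 2m + (1 + lq)^2 + q^2 (-l^2)$ is a certificate of degree $2k + 1$ for $L$ (lemmas
\<open>trunc_qmodule_perturb\<close>, \<open>minus_one_from_null_poly\<close>). Since $k \mapsto 2k + 1$ sends
$2^d - 1$ to $2^{d+1} - 1$, the exponential bound results.\<close>

section \<open>Real polynomials\<close>

lemma Const_0 [simp]: "Const 0 = 0"
  by (simp add: Const_def)

lemma Const_1 [simp]: "Const 1 = 1"
  by (simp add: Const_def)

lemma Const_add: "Const (a + b) = Const a + Const b"
  by (simp add: Const_def single_add)

lemma Const_mult: "Const (a * b) = Const a * Const b"
  by (simp add: Const_def mult_single)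

lemma Const_minus: "Const (- a) = - Const a"
  by (simp add: Const_def single_uminus)

lemma Const_sum: "Const (\<Sum>i\<in>I. f i) = (\<Sum>i\<in>I. Const (f i))"
  by (induction I rule: infinite_finite_induct) (auto simp: Const_add)

lemma mono_deg_superset:
  assumes "finite K" "Poly_Mapping.keys t \<subseteq> K"
  shows "mono_deg t = (\<Sum>i\<in>K. Poly_Mapping.lookup t i)"
  unfolding mono_deg_def using assms
  by (intro sum.mono_neutral_left) (auto simp: in_keys_iff)

lemma mono_deg_add: "mono_deg (s + t) = mono_deg s + mono_deg t"
proof -
  let ?K = "Poly_Mapping.keys s \<union> Poly_Mapping.keys t"
  have "mono_deg (s + t) = (\<Sum>i\<in>?K. Poly_Mapping.lookup (s + t) i)"
    by (intro mono_deg_superset) (auto dest: subsetD[OF Poly_Mapping.keys_add])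
  also have "\<dots> = mono_deg s + mono_deg t"
    by (simp add: mono_deg_superset[of ?K s] mono_deg_superset[of ?K t] lookup_add sum.distrib)
  finally show ?thesis .
qed

lemma polys_mono: "k \<le> k' \<Longrightarrow> polys n k \<subseteq> polys n k'"
  by (force simp: polys_def)

lemma polys_0 [simp]: "0 \<in> polys n k"
  by (simp add: polys_def)

lemma polys_Const [simp]: "Const c \<in> polys n k"
  by (simp add: polys_def Const_def mono_deg_def)

lemma polys_1 [simp]: "1 \<in> polys n k"
  using polys_Const[of 1] by simp

lemma polys_Var: "i < n \<Longrightarrow> 1 \<le> k \<Longrightarrow> Var i \<in> polys n k"
  by (simp add: polys_def Var_def mono_deg_def)

lemma polys_add: "p \<in> polys n k \<Longrightarrow> q \<in> polys n k \<Longrightarrow> p + q \<in> polys n k"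
  unfolding polys_def using Poly_Mapping.keys_add[of p q] by blast

lemma polys_minus: "p \<in> polys n k \<Longrightarrow> - p \<in> polys n k"
  by (simp add: polys_def)

lemma polys_sum: "(\<And>i. i \<in> I \<Longrightarrow> f i \<in> polys n k) \<Longrightarrow> (\<Sum>i\<in>I. f i) \<in> polys n k"
  by (induction I rule: infinite_finite_induct) (auto intro: polys_add)

lemma polys_mult:
  assumes "p \<in> polys n k" "q \<in> polys n l"
  shows "p * q \<in> polys n (k + l)"
  unfolding polys_def
proof (intro CollectI ballI)
  fix t assume "t \<in> Poly_Mapping.keys (p * q)"
  then obtain a b where t: "t = a + b" and
    ab: "a \<in> Poly_Mapping.keys p" "b \<in> Poly_Mapping.keys q"
    using Poly_Mapping.keys_mult[of p q] by blast
  have "Poly_Mapping.keys a \<subseteq> {..<n}" "Poly_Mapping.keys b \<subseteq> {..<n}"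
    "mono_deg a \<le> k" "mono_deg b \<le> l"
    using assms ab by (auto simp: polys_def)
  thus "Poly_Mapping.keys t \<subseteq> {..<n} \<and> mono_deg t \<le> k + l"
    unfolding t mono_deg_add using Poly_Mapping.keys_add[of a b] by auto
qed

lemma polys_Const_mult: "p \<in> polys n k \<Longrightarrow> Const c * p \<in> polys n k"
  using polys_mult[OF polys_Const[of c n 0]] by simp

lemma eval_poly_superset:
  assumes "finite K" "Poly_Mapping.keys p \<subseteq> K"
  shows "eval_poly x p = (\<Sum>t\<in>K. Poly_Mapping.lookup p t *
     (\<Prod>i\<in>Poly_Mapping.keys t. x i ^ Poly_Mapping.lookup t i))"
  unfolding eval_poly_def using assms
  by (intro sum.mono_neutral_left) (auto simp: in_keys_iff)

lemma eval_poly_add: "eval_poly x (p + q) = eval_poly x p + eval_poly x q"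
proof -
  let ?K = "Poly_Mapping.keys p \<union> Poly_Mapping.keys q"
  have "Poly_Mapping.keys (p + q) \<subseteq> ?K"
    by (rule Poly_Mapping.keys_add)
  thus ?thesis
    by (simp add: eval_poly_superset[of ?K] lookup_add algebra_simps sum.distrib)
qed

lemma eval_poly_0 [simp]: "eval_poly x 0 = 0"
  by (simp add: eval_poly_def)

lemma eval_poly_sum: "eval_poly x (\<Sum>i\<in>I. f i) = (\<Sum>i\<in>I. eval_poly x (f i))"
  by (induction I rule: infinite_finite_induct) (auto simp: eval_poly_add)

lemma eval_poly_Const [simp]: "eval_poly x (Const c) = c"
  by (simp add: eval_poly_def Const_def)

lemma eval_poly_Var_Const [simp]: "eval_poly x (Var i * Const c) = x i * c"
  by (simp add: eval_poly_def Const_def Var_def mult_single)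

definition affine_poly :: "nat set \<Rightarrow> real \<Rightarrow> (nat \<Rightarrow> real) \<Rightarrow> rpoly" where
  "affine_poly F c b = Const c + (\<Sum>i\<in>F. Var i * Const (b i))"

lemma eval_affine_poly: "eval_poly x (affine_poly F c b) = c + (\<Sum>i\<in>F. x i * b i)"
  by (simp add: affine_poly_def eval_poly_add eval_poly_sum)

lemma affine_poly_in_polys: "F \<subseteq> {..<n} \<Longrightarrow> 1 \<le> k \<Longrightarrow> affine_poly F c b \<in> polys n k"
  unfolding affine_poly_def
  by (intro polys_add polys_sum polys_Const polys_mult[of _ n k _ 0, simplified] polys_Var) auto

lemma affine_poly_add:
  "affine_poly F c b + affine_poly F c' b' = affine_poly F (c + c') (\<lambda>i. b i + b' i)"
  by (simp add: affine_poly_def Const_add algebra_simps sum.distrib)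

lemma affine_poly_Const_mult:
  "Const s * affine_poly F c b = affine_poly F (s * c) (\<lambda>i. s * b i)"
  by (simp add: affine_poly_def Const_mult algebra_simps sum_distrib_left)

lemma affine_poly_sum:
  "(\<Sum>j\<in>J. affine_poly F (c j) (b j)) = affine_poly F (\<Sum>j\<in>J. c j) (\<lambda>i. \<Sum>j\<in>J. b j i)"
  unfolding affine_poly_def sum.distrib Const_sum sum_distrib_left
  by (subst sum.swap) simp

lemma affine_poly_cong:
  "c = c' \<Longrightarrow> (\<And>i. i \<in> F \<Longrightarrow> b i = b' i) \<Longrightarrow> affine_poly F c b = affine_poly F c' b'"
  by (simp add: affine_poly_def)

lemma affine_poly_const: "(\<And>i. i \<in> F \<Longrightarrow> b i = 0) \<Longrightarrow> affine_poly F c b = Const c"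
  by (simp add: affine_poly_def)

section \<open>Quadratic forms and quadratic modules\<close>

definition bil :: "rpoly ^ 'm ^ 'm \<Rightarrow> rpoly ^ 'm \<Rightarrow> rpoly ^ 'm \<Rightarrow> rpoly" where
  "bil L u v = scalar_product u (L *v v)"

lemma bil_eq: "bil L u v = (\<Sum>j\<in>UNIV. \<Sum>k\<in>UNIV. u $ j * L $ j $ k * v $ k)"
  by (simp add: bil_def scalar_product_def matrix_vector_mult_def sum_distrib_left mult.assoc)

lemma bil_add_left: "bil L (u + u') v = bil L u v + bil L u' v"
  by (simp add: bil_eq algebra_simps sum.distrib)

lemma bil_add_right: "bil L u (v + v') = bil L u v + bil L u v'"
  by (simp add: bil_eq algebra_simps sum.distrib)

lemma bil_smult_left: "bil L (a *s u) v = a * bil L u v"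
  by (simp add: bil_eq sum_distrib_left algebra_simps)

lemma bil_smult_right: "bil L u (a *s v) = a * bil L u v"
  by (simp add: bil_eq sum_distrib_left algebra_simps)

lemma bil_commute: "transpose L = L \<Longrightarrow> bil L u v = bil L v u"
  unfolding bil_eq
  by (subst sum.swap) (auto simp: transpose_def vec_eq_iff mult.commute mult.left_commute)

definition const_vec :: "real ^ 'm \<Rightarrow> rpoly ^ 'm" where
  "const_vec u = (\<chi> j. Const (u $ j))"

text \<open>Only the variables in \<open>F\<close> occur, so that eliminating a variable removes it from \<open>F\<close> without
renaming the others.\<close>

definition pencil ::
  "nat set \<Rightarrow> real ^ 'm ^ 'm \<Rightarrow> (nat \<Rightarrow> real ^ 'm ^ 'm) \<Rightarrow> rpoly ^ 'm ^ 'm" where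
  "pencil F A0 A = (\<chi> j k. affine_poly F (A0 $ j $ k) (\<lambda>i. A i $ j $ k))"

lemma inner_matrix_vector:
  fixes u v :: "real ^ 'm"
  shows "u \<bullet> (A *v v) = (\<Sum>j\<in>UNIV. \<Sum>k\<in>UNIV. u $ j * v $ k * A $ j $ k)"
  by (simp add: inner_vec_def matrix_vector_mult_def sum_distrib_left algebra_simps)

lemma bil_pencil_const_vec:
  "bil (pencil F A0 A) (const_vec u) (const_vec v) =
     affine_poly F (u \<bullet> (A0 *v v)) (\<lambda>i. u \<bullet> (A i *v v))"
proof -
  have "bil (pencil F A0 A) (const_vec u) (const_vec v) =
    (\<Sum>j\<in>UNIV. \<Sum>k\<in>UNIV. Const (u $ j * v $ k) * affine_poly F (A0 $ j $ k) (\<lambda>i. A i $ j $ k))"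
    by (simp add: bil_eq pencil_def const_vec_def Const_mult algebra_simps)
  thus ?thesis
    by (simp add: affine_poly_Const_mult affine_poly_sum inner_matrix_vector)
qed

lemma transpose_pencil:
  assumes "transpose A0 = A0" "\<And>i. i \<in> F \<Longrightarrow> transpose (A i) = A i"
  shows "transpose (pencil F A0 A) = pencil F A0 A"
proof -
  have "A0 $ j $ k = A0 $ k $ j" for j k
    using assms(1) by (metis transpose_def vec_lambda_beta)
  moreover have "A i $ j $ k = A i $ k $ j" if "i \<in> F" for i j k
    using assms(2)[OF that] by (metis transpose_def vec_lambda_beta)
  ultimately show ?thesis
    by (simp add: transpose_def pencil_def affine_poly_def vec_eq_iff)
qed

lemma trunc_qmodule_mono: "k \<le> k' \<Longrightarrow> trunc_qmodule n L k \<subseteq> trunc_qmodule n L k'"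
  unfolding trunc_qmodule_def using polys_mono[of k k' n] by blast

lemma trunc_qmodule_0 [simp]: "0 \<in> trunc_qmodule n L k"
  unfolding trunc_qmodule_def by (force intro: exI[of _ "[]"])

lemma trunc_qmodule_add:
  assumes "f \<in> trunc_qmodule n L k" "g \<in> trunc_qmodule n L k"
  shows "f + g \<in> trunc_qmodule n L k"
proof -
  obtain ps vs ps' vs' where
    "f = (\<Sum>p\<leftarrow>ps. p\<^sup>2) + (\<Sum>v\<leftarrow>vs. scalar_product v (L *v v))"
    "set ps \<subseteq> polys n k" "\<forall>v\<in>set vs. \<forall>j. v $ j \<in> polys n k"
    "g = (\<Sum>p\<leftarrow>ps'. p\<^sup>2) + (\<Sum>v\<leftarrow>vs'. scalar_product v (L *v v))"
    "set ps' \<subseteq> polys n k" "\<forall>v\<in>set vs'. \<forall>j. v $ j \<in> polys n k"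
    using assms unfolding trunc_qmodule_def by blast
  thus ?thesis
    unfolding trunc_qmodule_def
    by (intro CollectI exI[of _ "ps @ ps'"] exI[of _ "vs @ vs'"]) (auto simp: algebra_simps)
qed

lemma trunc_qmodule_sum:
  "(\<And>i. i \<in> I \<Longrightarrow> f i \<in> trunc_qmodule n L k) \<Longrightarrow> (\<Sum>i\<in>I. f i) \<in> trunc_qmodule n L k"
  by (induction I rule: infinite_finite_induct) (auto intro: trunc_qmodule_add)

lemma trunc_qmodule_square:
  "p \<in> polys n k \<Longrightarrow> p\<^sup>2 \<in> trunc_qmodule n L k"
  unfolding trunc_qmodule_def by (intro CollectI exI[of _ "[p]"] exI[of _ "[]"]) simp

lemma trunc_qmodule_bil:
  "(\<And>j. v $ j \<in> polys n k) \<Longrightarrow> bil L v v \<in> trunc_qmodule n L k"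
  unfolding trunc_qmodule_def bil_def by (force intro!: exI[of _ "[]"] exI[of _ "[v]"])

text \<open>Adding one generator at a time spares later proofs the bookkeeping with two lists.\<close>

lemma trunc_qmodule_induct [consumes 1, case_names zero square form]:
  assumes "f \<in> trunc_qmodule n L k"
    and "P 0"
    and "\<And>p f. p \<in> polys n k \<Longrightarrow> P f \<Longrightarrow> P (p\<^sup>2 + f)"
    and "\<And>v f. (\<And>j. v $ j \<in> polys n k) \<Longrightarrow> P f \<Longrightarrow> P (bil L v v + f)"
  shows "P f"
proof -
  have forms: "P (\<Sum>v\<leftarrow>vs. bil L v v)" if "\<forall>v\<in>set vs. \<forall>j. v $ j \<in> polys n k" for vs
    using that by (induction vs) (auto intro: assms)
  have "P ((\<Sum>p\<leftarrow>ps. p\<^sup>2) + (\<Sum>v\<leftarrow>vs. bil L v v))"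
    if "set ps \<subseteq> polys n k" "\<forall>v\<in>set vs. \<forall>j. v $ j \<in> polys n k" for ps vs
    using that(1) by (induction ps) (auto simp: forms that(2) add.assoc intro: assms)
  thus ?thesis
    using assms(1) unfolding trunc_qmodule_def bil_def by blast
qed

lemma trunc_qmodule_mult_square:
  assumes "f \<in> trunc_qmodule n L k" "q \<in> polys n l"
  shows "q\<^sup>2 * f \<in> trunc_qmodule n L (k + l)"
  using assms(1)
proof (induction rule: trunc_qmodule_induct)
  case zero
  show ?case by simp
next
  case (square p f)
  have "(p * q)\<^sup>2 \<in> trunc_qmodule n L (k + l)"
    by (intro trunc_qmodule_square polys_mult square assms)
  from trunc_qmodule_add[OF this square(2)] show ?case
    by (simp add: algebra_simps power_mult_distrib)
next
  case (form v f)
  have "bil L (q *s v) (q *s v) \<in> trunc_qmodule n L (k + l)"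
    using polys_mult[OF form(1) assms(2)]
    by (intro trunc_qmodule_bil) (simp add: mult.commute)
  from trunc_qmodule_add[OF this form(2)] show ?case
    by (simp add: bil_smult_left bil_smult_right algebra_simps power2_eq_square)
qed

lemma trunc_qmodule_Const_mult:
  assumes "f \<in> trunc_qmodule n L k" "0 \<le> c"
  shows "Const c * f \<in> trunc_qmodule n L k"
  using trunc_qmodule_mult_square[OF assms(1) polys_Const[of "sqrt c" n 0]] assms(2)
  by (simp add: power2_eq_square flip: Const_mult)

text \<open>A change of the pencil by a multiple of \<open>l\<close> is paid for by a multiple of \<open>l\<close>. The
cofactor is a sum of terms $v^* D v$ with \<open>D\<close> real, so its degree is at most twice that of the
vectors \<open>v\<close> in the certificate.\<close>

lemma trunc_qmodule_perturb:
  assumes "f \<in> trunc_qmodule n L' k"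
    and L: "\<And>j r. L' $ j $ r = L $ j $ r + l * Const (D $ j $ r)"
  shows "\<exists>m q. m \<in> trunc_qmodule n L k \<and> q \<in> polys n (k + k) \<and> f = m + l * q"
  using assms(1)
proof (induction rule: trunc_qmodule_induct)
  case zero
  show ?case by (intro exI[of _ 0]) simp
next
  case (square p f)
  then obtain m q where mq: "m \<in> trunc_qmodule n L k" "q \<in> polys n (k + k)" "f = m + l * q"
    by blast
  thus ?case
    using trunc_qmodule_add[OF trunc_qmodule_square[OF square(1)] mq(1)]
    by (intro exI[of _ "p\<^sup>2 + m"] exI[of _ q]) (simp add: add.assoc)
next
  case (form v f)
  then obtain m q where mq: "m \<in> trunc_qmodule n L k" "q \<in> polys n (k + k)" "f = m + l * q"
    by blast
  define d where "d = (\<Sum>j\<in>UNIV. \<Sum>r\<in>UNIV. v $ j * v $ r * Const (D $ j $ r))"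
  have "d \<in> polys n (k + k)"
    unfolding d_def
    by (intro polys_sum polys_mult[of _ n "k + k" _ 0, simplified] polys_mult form polys_Const)
  moreover have "bil L' v v = bil L v v + l * d"
    by (simp add: bil_eq L d_def algebra_simps sum.distrib sum_distrib_left)
  ultimately show ?case
    using mq trunc_qmodule_add[OF trunc_qmodule_bil[OF form(1)] mq(1)]
    by (intro exI[of _ "bil L v v + m"] exI[of _ "d + q"]) (simp add: algebra_simps polys_add)
qed

section \<open>An alternative for pencils of real matrices\<close>

definition pencil_at ::
  "nat set \<Rightarrow> real ^ 'm ^ 'm \<Rightarrow> (nat \<Rightarrow> real ^ 'm ^ 'm) \<Rightarrow> (nat \<Rightarrow> real) \<Rightarrow> real ^ 'm ^ 'm" where
  "pencil_at F A0 A x = A0 + (\<Sum>i\<in>F. x i *\<^sub>R A i)"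

lemma matrix_vector_mult_sum: "(\<Sum>i\<in>I. M i) *v u = (\<Sum>i\<in>I. M i *v (u :: real ^ 'm))"
  by (induction I rule: infinite_finite_induct) (auto simp: matrix_vector_mult_add_rdistrib)

lemma pencil_at_mult_vec:
  "pencil_at F A0 A x *v u = A0 *v u + (\<Sum>i\<in>F. x i *\<^sub>R (A i *v u))"
  by (simp add: pencil_at_def matrix_vector_mult_add_rdistrib matrix_vector_mult_sum
      scaleR_matrix_vector_assoc)

lemma transpose_pencil_at:
  assumes "transpose A0 = A0" "\<And>i. i \<in> F \<Longrightarrow> transpose (A i) = A i"
  shows "transpose (pencil_at F A0 A x) = pencil_at F A0 A x"
proof -
  have "transpose (pencil_at F A0 A x) = transpose A0 + (\<Sum>i\<in>F. x i *\<^sub>R transpose (A i))"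
    by (simp add: pencil_at_def transpose_def vec_eq_iff)
  thus ?thesis using assms by (simp add: pencil_at_def)
qed

definition outer_square :: "real ^ 'm \<Rightarrow> real ^ 'm ^ 'm" where
  "outer_square u = (\<chi> j k. u $ j * u $ k)"

lemma inner_outer_square: "B \<bullet> outer_square u = u \<bullet> (B *v u)"
  unfolding inner_matrix_vector by (simp add: outer_square_def inner_vec_def mult.commute)

lemma continuous_on_outer_square: "continuous_on S outer_square"
  unfolding outer_square_def by (intro continuous_intros)

text \<open>The separation argument only controls the form on the complement of the common kernel; symmetry
makes the mixed terms of the orthogonal decomposition vanish.\<close>

lemma psd_if_psd_on_complement:
  fixes B :: "real ^ 'm ^ 'm"
  assumes sym: "transpose B = B"
    and N: "subspace N" "\<And>u. u \<in> N \<Longrightarrow> B *v u = 0"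
    and pos: "\<And>u. u \<in> N\<^sup>\<bottom> \<Longrightarrow> 0 \<le> u \<bullet> (B *v u)"
  shows "psd B"
  unfolding psd_def
proof (intro conjI allI sym)
  fix w :: "real ^ 'm"
  obtain p q where pq: "p \<in> span N" "\<And>z. z \<in> span N \<Longrightarrow> orthogonal q z" "w = p + q"
    using orthogonal_subspace_decomp_exists[of N w] by blast
  have p: "p \<in> N" and q: "q \<in> N\<^sup>\<bottom>"
    using pq(1,2) unfolding iffD2[OF span_eq_iff N(1)]
    by (simp_all add: orthogonal_comp_def orthogonal_commute)
  have "p \<bullet> (B *v q) = (B *v p) \<bullet> q"
    by (metis dot_lmul_matrix sym vector_transpose_matrix)
  thus "0 \<le> w \<bullet> (B *v w)"
    using N(2)[OF p] pos[OF q]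
    by (simp add: pq(3) matrix_vector_right_distrib inner_add_left)
qed

text \<open>This is the dual side of infeasibility. The additional coordinate \<open>c\<close> stands for the extra block
$(1)$ of $L \oplus (1)$; it forces the separating functional to give a positive weight \<open>t\<close> to
the constant coefficient \<open>A0\<close>, so that division by \<open>t\<close> yields a point where the pencil is
positive semidefinite. Restricting \<open>u\<close> to the complement of the common kernel gives the fifth
conclusion; without it the combination could consist of vectors that every coefficient annihilates.
The index set \<open>T\<close> consists of the pairs $(uu^*, c^2)$ themselves.\<close>

lemma infeasible_pencil_null_combination:
  fixes A0 :: "real ^ 'm ^ 'm"
  assumes "finite F"
    and sym: "transpose A0 = A0" "\<And>i. i \<in> F \<Longrightarrow> transpose (A i) = A i"
    and infeasible: "\<And>x. \<not> psd (pencil_at F A0 A x)"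
  obtains T :: "((real ^ 'm ^ 'm) \<times> real) set" and lam u c where
    "finite T" "\<And>y. y \<in> T \<Longrightarrow> 0 \<le> lam y" "sum lam T = 1"
    "\<And>y. y \<in> T \<Longrightarrow> norm (u y) ^ 2 + c y ^ 2 = 1"
    "\<And>y. y \<in> T \<Longrightarrow> u y \<noteq> 0 \<Longrightarrow> A0 *v u y \<noteq> 0 \<or> (\<exists>i\<in>F. A i *v u y \<noteq> 0)"
    "(\<Sum>y\<in>T. lam y * (u y \<bullet> (A0 *v u y) + c y ^ 2)) = 0"
    "\<And>i. i \<in> F \<Longrightarrow> (\<Sum>y\<in>T. lam y * (u y \<bullet> (A i *v u y))) = 0"
proof -
  define N where "N = {u. A0 *v u = 0 \<and> (\<forall>i\<in>F. A i *v u = 0)}"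
  have N: "subspace N"
    by (auto simp: N_def subspace_def matrix_vector_right_distrib matrix_vector_mult_scaleR)
  define D where "D = {(u, c). u \<in> N\<^sup>\<bottom> \<and> norm u ^ 2 + c ^ 2 = (1 :: real)}"
  define g where "g = (\<lambda>(u :: real ^ 'm, c :: real). (outer_square u, c ^ 2))"
  define V where "V = {(t *\<^sub>R A0 + (\<Sum>i\<in>F. x i *\<^sub>R A i), t) |t x. True}"
  have VI: "(t *\<^sub>R A0 + (\<Sum>i\<in>F. x i *\<^sub>R A i), t) \<in> V" for t x
    unfolding V_def by (intro CollectI exI[of _ t] exI[of _ x]) simp
  have V: "subspace V"
    unfolding subspace_def
  proof (intro conjI ballI allI)
    show "0 \<in> V"
      by (auto simp: V_def zero_prod_def intro!: exI[of _ 0] exI[of _ "\<lambda>_. 0"])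
  next
    fix a b assume "a \<in> V" "b \<in> V"
    then obtain t x t' x' where
      "a = (t *\<^sub>R A0 + (\<Sum>i\<in>F. x i *\<^sub>R A i), t)"
      "b = (t' *\<^sub>R A0 + (\<Sum>i\<in>F. x' i *\<^sub>R A i), t')"
      by (auto simp: V_def)
    hence "a + b = ((t + t') *\<^sub>R A0 + (\<Sum>i\<in>F. (x i + x' i) *\<^sub>R A i), t + t')"
      by (simp add: algebra_simps sum.distrib)
    thus "a + b \<in> V" using VI[of "t + t'" "\<lambda>i. x i + x' i"] by simp
  next
    fix s a assume "a \<in> V"
    then obtain t x where "a = (t *\<^sub>R A0 + (\<Sum>i\<in>F. x i *\<^sub>R A i), t)"
      by (auto simp: V_def)
    hence "s *\<^sub>R a = ((s * t) *\<^sub>R A0 + (\<Sum>i\<in>F. (s * x i) *\<^sub>R A i), s * t)"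
      by (simp add: algebra_simps scaleR_sum_right)
    thus "s *\<^sub>R a \<in> V" using VI[of "s * t" "\<lambda>i. s * x i"] by simp
  qed
  have "compact D"
    unfolding compact_eq_bounded_closed
  proof
    have "norm z \<le> 2" if "z \<in> D" for z
    proof -
      obtain u c where z: "z = (u, c)" by (cases z)
      have "norm u ^ 2 + c ^ 2 = 1" using that by (simp add: D_def z)
      thus ?thesis by (simp add: z norm_Pair)
    qed
    thus "bounded D" unfolding bounded_iff by blast
    have "D = ((N\<^sup>\<bottom>) \<times> UNIV) \<inter> {z. norm (fst z) ^ 2 + snd z ^ 2 = 1}"
      by (auto simp: D_def)
    moreover have "closed {z :: (real ^ 'm) \<times> real. norm (fst z) ^ 2 + snd z ^ 2 = 1}"
      by (intro closed_Collect_eq continuous_intros)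
    ultimately show "closed D"
      by (simp add: closed_Int closed_Times closed_subspace subspace_orthogonal_comp)
  qed
  moreover have "continuous_on D g"
    unfolding g_def case_prod_unfold
    by (intro continuous_intros continuous_on_compose2[OF continuous_on_outer_square[of UNIV]]) auto
  ultimately have hull: "compact (convex hull (g ` D))"
    by (intro compact_convex_hull compact_continuous_image)
  have one: "g (0, 1) \<in> g ` D"
    by (intro imageI) (auto simp: D_def subspace_0 subspace_orthogonal_comp)
  have "V\<^sup>\<bottom> \<inter> convex hull (g ` D) \<noteq> {}"
  proof
    assume disj: "V\<^sup>\<bottom> \<inter> convex hull (g ` D) = {}"
    have "\<exists>a b. (\<forall>z\<in>V\<^sup>\<bottom>. a \<bullet> z < b) \<and> (\<forall>z\<in>convex hull (g ` D). b < a \<bullet> z)"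
      using one hull disj
      by (intro separating_hyperplane_closed_compact)
        (auto simp: subspace_orthogonal_comp subspace_imp_convex closed_subspace)
    then obtain a b where ab: "\<And>z. z \<in> V\<^sup>\<bottom> \<Longrightarrow> a \<bullet> z < b"
      "\<And>z. z \<in> convex hull (g ` D) \<Longrightarrow> b < a \<bullet> z" by blast
    have "0 < b" using ab(1)[of 0] by (simp add: subspace_0 subspace_orthogonal_comp)
    hence pos: "0 < a \<bullet> g z" if "z \<in> D" for z
      using ab(2)[OF hull_inc[OF imageI[OF that]]] by simp
    \<comment> \<open>A linear functional bounded above on a subspace vanishes there; here a multiple of \<open>z\<close> would attain the bound \<open>b\<close>.\<close>
    have "a \<bullet> z = 0" if z: "z \<in> V\<^sup>\<bottom>" for z
    proof (rule ccontr)
      assume ne: "a \<bullet> z \<noteq> 0"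
      have "(b / (a \<bullet> z)) *\<^sub>R z \<in> V\<^sup>\<bottom>"
        using z subspace_orthogonal_comp by (rule subspace_mul[rotated])
      from ab(1)[OF this] ne show False by simp
    qed
    hence "a \<in> V\<^sup>\<bottom>\<^sup>\<bottom>"
      by (auto simp: orthogonal_comp_def[of "V\<^sup>\<bottom>"] orthogonal_def inner_commute)
    hence "a \<in> V" by (simp add: orthogonal_comp_self V)
    then obtain t x where a: "a = (t *\<^sub>R A0 + (\<Sum>i\<in>F. x i *\<^sub>R A i), t)"
      by (auto simp: V_def)
    have "outer_square 0 = (0 :: real ^ 'm ^ 'm)" by (simp add: outer_square_def vec_eq_iff)
    \<comment> \<open>The test pair without vector part isolates the weight of the constant coefficient.\<close>
    hence t: "0 < t"
      using pos[of "(0, 1)"] by (simp add: D_def g_def a subspace_0 subspace_orthogonal_comp)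
    define B where "B = pencil_at F A0 A (\<lambda>i. x i / t)"
    have tB: "t *\<^sub>R A0 + (\<Sum>i\<in>F. x i *\<^sub>R A i) = t *\<^sub>R B"
      using t by (simp add: B_def pencil_at_def scaleR_right_distrib scaleR_sum_right)
    have "psd B"
    proof (rule psd_if_psd_on_complement[OF _ N])
      show "transpose B = B" unfolding B_def by (intro transpose_pencil_at sym)
      show "B *v u = 0" if "u \<in> N" for u
        using that by (simp add: B_def pencil_at_mult_vec N_def)
      show "0 \<le> u \<bullet> (B *v u)" if u: "u \<in> N\<^sup>\<bottom>" for u
      proof (cases "u = 0")
        case False
        let ?s = "inverse (norm u)"
        have "?s *\<^sub>R u \<in> N\<^sup>\<bottom>"
          using subspace_orthogonal_comp u by (rule subspace_mul)
        hence "(?s *\<^sub>R u, 0) \<in> D" using False by (simp add: D_def)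
        from pos[OF this] have prod: "0 < ?s * t * (?s * (u \<bullet> (B *v u)))"
          by (simp add: g_def a tB inner_outer_square matrix_vector_mult_scaleR
              flip: scaleR_matrix_vector_assoc)
        have s: "0 < ?s" and st: "0 < ?s * t" using False t by simp_all
        show ?thesis using zero_less_mult_pos[OF zero_less_mult_pos[OF prod st] s] by simp
      qed simp
    qed
    thus False using infeasible unfolding B_def by blast
  qed
  then obtain z where z: "z \<in> V\<^sup>\<bottom>" "z \<in> convex hull (g ` D)" by blast
  obtain T lam where T: "finite T" "T \<subseteq> g ` D" "\<forall>y\<in>T. 0 \<le> lam y" "sum lam T = 1"
    and z_eq: "(\<Sum>y\<in>T. lam y *\<^sub>R y) = z"
    using z(2) unfolding convex_hull_explicit mem_Collect_eq by (elim exE conjE)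
  \<comment> \<open>Return from the test matrices to the vectors that they come from.\<close>
  define u c where "u = (\<lambda>y. fst (inv_into D g y))" and "c = (\<lambda>y. snd (inv_into D g y))"
  have D: "(u y, c y) \<in> D" and y_eq: "g (u y, c y) = y" if "y \<in> T" for y
  proof -
    have "y \<in> g ` D" using T(2) that by blast
    thus "(u y, c y) \<in> D" "g (u y, c y) = y"
      unfolding u_def c_def by (simp_all add: inv_into_into f_inv_into_f)
  qed
  have uc: "u y \<in> N\<^sup>\<bottom>" "norm (u y) ^ 2 + c y ^ 2 = 1" if "y \<in> T" for y
    using D[OF that] by (simp_all add: D_def)
  have null: "(\<Sum>y\<in>T. lam y * (u y \<bullet> (B *v u y) + t * c y ^ 2)) = 0" if "(B, t) \<in> V" for B t
  proof -
    have "0 = (B, t) \<bullet> (\<Sum>y\<in>T. lam y *\<^sub>R y)"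
      using z(1) that unfolding z_eq by (auto simp: orthogonal_comp_def orthogonal_def)
    also have "\<dots> = (\<Sum>y\<in>T. lam y * ((B, t) \<bullet> y))"
      by (simp add: inner_sum_right)
    also have "\<dots> = (\<Sum>y\<in>T. lam y * ((B, t) \<bullet> g (u y, c y)))"
      by (intro sum.cong refl) (simp only: y_eq)
    finally show ?thesis by (simp add: g_def inner_outer_square)
  qed
  show thesis
  proof (rule that[of T lam u c])
    show "A0 *v u y \<noteq> 0 \<or> (\<exists>i\<in>F. A i *v u y \<noteq> 0)" if "y \<in> T" "u y \<noteq> 0" for y
    proof (rule ccontr)
      assume "\<not> ?thesis"
      hence "u y \<in> N" by (auto simp: N_def)
      with uc(1)[OF that(1)] have "u y = 0" using orthogonal_Int_0[OF N] by blast
      with that(2) show False by simp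
    qed
    have "(A0, 1) \<in> V" using VI[of 1 "\<lambda>_. 0"] by simp
    from null[OF this] show "(\<Sum>y\<in>T. lam y * (u y \<bullet> (A0 *v u y) + c y ^ 2)) = 0" by simp
    show "(\<Sum>y\<in>T. lam y * (u y \<bullet> (A i *v u y))) = 0" if "i \<in> F" for i
    proof -
      have "(\<Sum>j\<in>F. (if j = i then 1 else 0) *\<^sub>R A j) = (\<Sum>j\<in>F. if j = i then A j else 0)"
        by (intro sum.cong) auto
      also have "\<dots> = A i" using that \<open>finite F\<close> by simp
      finally have "(A i, 0) \<in> V" using VI[of 0 "\<lambda>j. if j = i then 1 else 0"] by simp
      from null[OF this] show ?thesis by simp
    qed
  qed (use T uc in auto)
qed

section \<open>Certificates for a vanishing affine polynomial\<close>

text \<open>The identity behind this is $-4l^2 = (1-l)^2 l + (1+l)^2 (-l)$.\<close>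

lemma minus_square_if_both_signs:
  assumes "l \<in> trunc_qmodule n L 0" "- l \<in> trunc_qmodule n L 0" "l \<in> polys n 1"
  shows "- l\<^sup>2 \<in> trunc_qmodule n L 1"
proof -
  have "(1 + - l)\<^sup>2 * l \<in> trunc_qmodule n L (0 + 1)"
    by (intro trunc_qmodule_mult_square assms polys_add polys_minus polys_1)
  moreover have "(1 + l)\<^sup>2 * - l \<in> trunc_qmodule n L (0 + 1)"
    by (intro trunc_qmodule_mult_square assms polys_add polys_1)
  ultimately have "(1 + - l)\<^sup>2 * l + (1 + l)\<^sup>2 * - l \<in> trunc_qmodule n L 1"
    using trunc_qmodule_add by fastforce
  hence "Const (1/4) * ((1 + - l)\<^sup>2 * l + (1 + l)\<^sup>2 * - l) \<in> trunc_qmodule n L 1"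
    by (intro trunc_qmodule_Const_mult) auto
  moreover have "(1 + - l)\<^sup>2 * l + (1 + l)\<^sup>2 * - l = Const 4 * - l\<^sup>2"
  proof -
    have "Const 4 = 1 + 1 + 1 + 1"
      by (simp flip: Const_1 Const_add)
    thus ?thesis by (simp add: algebra_simps power2_eq_square)
  qed
  moreover have "Const (1/4) * (Const 4 * - l\<^sup>2) = - l\<^sup>2"
  proof -
    have "Const (1/4) * (Const 4 * - l\<^sup>2) = Const (1/4 * 4) * - l\<^sup>2"
      unfolding Const_mult by (rule mult.assoc [symmetric])
    thus ?thesis by simp
  qed
  ultimately show ?thesis by metis
qed

text \<open>With $l = w^* L u$ and $g = w^* L w$, the vector $v = a u + l w$ gives
$v^* L v = 2 a l^2 + g l^2$, as \<open>u\<close> is isotropic; the choice $a = -(1 + g)/2$ turns this into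
$-l^2$. Scaling \<open>w\<close> by \<open>l\<close> rather than by a constant is what produces an exact
certificate instead of one up to an arbitrarily small error.\<close>

lemma minus_square_if_isotropic:
  assumes sym: "transpose L = L"
    and iso: "bil L (const_vec u) (const_vec u) = 0"
    and l: "bil L (const_vec w) (const_vec u) \<in> polys n 1"
    and g: "bil L (const_vec w) (const_vec w) \<in> polys n 1"
  shows "- (bil L (const_vec w) (const_vec u))\<^sup>2 \<in> trunc_qmodule n L 1"
proof -
  let ?l = "bil L (const_vec w) (const_vec u)" and ?g = "bil L (const_vec w) (const_vec w)"
  define a where "a = - (Const (1/2) * (1 + ?g))"
  define v where "v = a *s const_vec u + ?l *s const_vec w"
  have a: "a \<in> polys n 1"
    unfolding a_def
    by (intro polys_minus polys_Const_mult polys_add polys_1 g)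
  have "v $ j \<in> polys n 1" for j
    using polys_mult[OF a polys_Const[of "u $ j" n 0]] polys_mult[OF l polys_Const[of "w $ j" n 0]]
    by (auto simp: v_def const_vec_def intro!: polys_add)
  hence "bil L v v \<in> trunc_qmodule n L 1"
    by (rule trunc_qmodule_bil)
  moreover have "bil L v v = ?l\<^sup>2 * (a + a + ?g)"
    unfolding v_def using bil_commute[OF sym, of "const_vec u" "const_vec w"]
    by (simp add: bil_add_left bil_add_right bil_smult_left bil_smult_right iso
        algebra_simps power2_eq_square)
  moreover have "a + a = - (1 + ?g)"
  proof -
    have "a + a = - ((Const (1/2) + Const (1/2)) * (1 + ?g))"
      unfolding a_def by (simp add: algebra_simps)
    thus ?thesis by (simp flip: Const_add)
  qed
  ultimately show ?thesis by (simp add: algebra_simps)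
qed

text \<open>From $-2 = 2m + 2lq$ one gets $-1 = 2m + (1 + lq)^2 + q^2 (-l^2)$.\<close>

lemma minus_one_from_null_poly:
  assumes m: "m \<in> trunc_qmodule n L k" and q: "q \<in> polys n (k + k)"
    and eq: "- 1 = m + l * q"
    and l: "l \<in> polys n 1" "- l\<^sup>2 \<in> trunc_qmodule n L 1"
  shows "- 1 \<in> trunc_qmodule n L (k + k + 1)"
proof -
  have "m \<in> trunc_qmodule n L (k + k + 1)"
    using m trunc_qmodule_mono[of k "k + k + 1" n L] by auto
  moreover have "(1 + q * l)\<^sup>2 \<in> trunc_qmodule n L (k + k + 1)"
    by (intro trunc_qmodule_square polys_add polys_1 polys_mult q l)
  moreover have "q\<^sup>2 * - l\<^sup>2 \<in> trunc_qmodule n L (k + k + 1)"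
    using trunc_qmodule_mult_square[OF l(2) q] by (simp add: add.commute)
  ultimately have "m + m + (1 + q * l)\<^sup>2 + q\<^sup>2 * - l\<^sup>2 \<in> trunc_qmodule n L (k + k + 1)"
    by (intro trunc_qmodule_add)
  moreover have "m = - 1 - l * q"
    using eq by (simp add: algebra_simps)
  ultimately show ?thesis
    by (simp add: algebra_simps power2_eq_square)
qed

text \<open>A vanishing convex combination of terms $u^* L u + c^2$ can be solved for $-1$ if some $c^2$ has
positive weight. Otherwise some $u \<noteq> 0$ has positive weight, and either $u^* L u$ and its negative
are both sums of values of $L$, or \<open>u\<close> is isotropic but not annihilated by $L$.
The nonvanishing of the affine polynomial is stated through its coefficients. It may be a nonzero
constant, in which case the second alternative is a certificate of degree one for infeasibility.\<close>

lemma infeasible_pencil_dichotomy: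
  assumes F: "F \<subseteq> {..<n}"
    and sym: "transpose A0 = A0" "\<And>i. i \<in> F \<Longrightarrow> transpose (A i) = A i"
    and infeasible: "\<And>x. \<not> psd (pencil_at F A0 A x)"
  shows "- 1 \<in> trunc_qmodule n (pencil F A0 A) 0 \<or>
    (\<exists>c b. (c \<noteq> 0 \<or> (\<exists>i\<in>F. b i \<noteq> 0)) \<and>
       - (affine_poly F c b)\<^sup>2 \<in> trunc_qmodule n (pencil F A0 A) 1)"
proof -
  let ?L = "pencil F A0 A"
  let ?M = "trunc_qmodule n ?L"
  have "finite F" using F finite_subset by blast
  from infeasible_pencil_null_combination[OF this sym infeasible]
  obtain T :: "((real ^ 'a ^ 'a) \<times> real) set" and lam u c where T: "finite T"
    and lam: "\<And>y. y \<in> T \<Longrightarrow> 0 \<le> lam y" "sum lam T = 1"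
    and unit: "\<And>y. y \<in> T \<Longrightarrow> norm (u y) ^ 2 + c y ^ 2 = 1"
    and notker: "\<And>y. y \<in> T \<Longrightarrow> u y \<noteq> 0 \<Longrightarrow> A0 *v u y \<noteq> 0 \<or> (\<exists>i\<in>F. A i *v u y \<noteq> 0)"
    and null0: "(\<Sum>y\<in>T. lam y * (u y \<bullet> (A0 *v u y) + c y ^ 2)) = 0"
    and null: "\<And>i. i \<in> F \<Longrightarrow> (\<Sum>y\<in>T. lam y * (u y \<bullet> (A i *v u y))) = 0"
    by blast
  define form where "form = (\<lambda>w z. affine_poly F (w \<bullet> (A0 *v z)) (\<lambda>i. w \<bullet> (A i *v z)))"
  have form: "bil ?L (const_vec w) (const_vec z) = form w z" for w z
    unfolding form_def by (rule bil_pencil_const_vec)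
  have form_polys: "form w z \<in> polys n 1" for w z
    unfolding form_def by (intro affine_poly_in_polys F) simp
  have form_M: "form w w \<in> ?M 0" for w
    unfolding form[symmetric] by (intro trunc_qmodule_bil) (simp add: const_vec_def)
  have via_form: ?thesis
    if "w \<bullet> (A0 *v z) \<noteq> 0 \<or> (\<exists>i\<in>F. w \<bullet> (A i *v z) \<noteq> 0)" "- (form w z)\<^sup>2 \<in> ?M 1" for w z
    by (insert that, unfold form_def, intro disjI2 exI[of _ "w \<bullet> (A0 *v z)"]
        exI[of _ "\<lambda>i. w \<bullet> (A i *v z)"], rule conjI)
  \<comment> \<open>The total weight of the block $(1)$ decides between the two alternatives.\<close>
  define s where "s = (\<Sum>y\<in>T. lam y * c y ^ 2)"
  have sum_form: "(\<Sum>y\<in>T. Const (lam y) * form (u y) (u y)) = Const (- s)"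
  proof -
    have "(\<Sum>y\<in>T. lam y * (u y \<bullet> (A0 *v u y))) = - s"
      using null0 by (simp add: s_def distrib_left sum.distrib)
    thus ?thesis
      by (simp add: form_def affine_poly_Const_mult affine_poly_sum null affine_poly_const)
  qed
  have "0 \<le> s" unfolding s_def by (intro sum_nonneg) (simp add: lam)
  then consider "0 < s" | "s = 0" by linarith
  thus ?thesis
  proof cases
    case 1
    have "(\<Sum>y\<in>T. Const (lam y) * form (u y) (u y)) \<in> ?M 0"
      by (intro trunc_qmodule_sum trunc_qmodule_Const_mult form_M lam)
    hence "Const (1 / s) * Const (- s) \<in> ?M 0"
      unfolding sum_form using 1 by (intro trunc_qmodule_Const_mult) auto
    moreover have "Const (1 / s) * Const (- s) = - 1"
      using 1 by (simp flip: Const_mult add: Const_minus)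
    ultimately show ?thesis by simp
  next
    case 2
    obtain y where y: "y \<in> T" "0 < lam y"
      using lam by (metis less_eq_real_def sum.neutral zero_neq_one)
    have "lam y * c y ^ 2 = 0"
      using 2 y(1) T lam unfolding s_def by (subst (asm) sum_nonneg_eq_0_iff) auto
    hence u: "u y \<noteq> 0" using y(2) unit[OF y(1)] by auto
    show ?thesis
    proof (cases "u y \<bullet> (A0 *v u y) = 0 \<and> (\<forall>i\<in>F. u y \<bullet> (A i *v u y) = 0)")
      case False
      let ?l = "form (u y) (u y)"
      \<comment> \<open>The vanishing combination expresses the negative of this summand by the others.\<close>
      have rest: "(\<Sum>z\<in>T - {y}. Const (lam z) * form (u z) (u z)) \<in> ?M 0"
        by (intro trunc_qmodule_sum trunc_qmodule_Const_mult form_M lam) auto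
      have "Const (lam y) * ?l + (\<Sum>z\<in>T - {y}. Const (lam z) * form (u z) (u z)) = 0"
        using sum_form 2 by (simp add: sum.remove[OF T y(1)])
      hence "(\<Sum>z\<in>T - {y}. Const (lam z) * form (u z) (u z)) = Const (lam y) * - ?l"
        by (simp add: eq_neg_iff_add_eq_0 add.commute)
      with rest have "Const (lam y) * - ?l \<in> ?M 0" by simp
      from trunc_qmodule_Const_mult[OF this, of "1 / lam y"] y(2)
      have "Const (1 / lam y) * (Const (lam y) * - ?l) \<in> ?M 0"
        by (simp only: zero_le_divide_1_iff less_imp_le)
      moreover have "Const (1 / lam y) * (Const (lam y) * - ?l) = - ?l"
        unfolding mult.assoc[symmetric] Const_mult[symmetric] using y(2) by simp
      ultimately have minus: "- ?l \<in> ?M 0" by (simp only:)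
      have "- ?l\<^sup>2 \<in> ?M 1"
        by (rule minus_square_if_both_signs[OF form_M minus form_polys])
      with False show ?thesis by (intro via_form[of "u y" "u y"]) auto
    next
      case True
      hence iso: "form (u y) (u y) = 0"
        unfolding form_def by (subst affine_poly_const) auto
      obtain w where w: "w \<bullet> (A0 *v u y) \<noteq> 0 \<or> (\<exists>i\<in>F. w \<bullet> (A i *v u y) \<noteq> 0)"
        using notker[OF y(1) u] by (metis inner_eq_zero_iff)
      have "- (form w (u y))\<^sup>2 \<in> ?M 1"
        using minus_square_if_isotropic[of ?L "u y" w n] transpose_pencil[OF sym] iso form_polys
        by (simp add: form)
      with w show ?thesis by (rule via_form)
    qed
  qed
qed

section \<open>Eliminating variables\<close>

text \<open>The induction keeps the ambient variables and shrinks the set \<open>F\<close> of those that occur. Any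
certificate for the smaller pencil is then already written in the right polynomial ring, and no
substitution into it is needed.\<close>

lemma minus_one_in_trunc_qmodule_pencil:
  assumes "F \<subseteq> {..<n}"
    and "transpose A0 = A0" "\<And>i. i \<in> F \<Longrightarrow> transpose (A i) = A i"
    and "\<And>x. \<not> psd (pencil_at F A0 A x)"
  shows "- 1 \<in> trunc_qmodule n (pencil F A0 A) (2 ^ card F - 1)"
  using assms
proof (induction "card F" arbitrary: F A0 A)
  case 0
  hence F: "F = {}" using finite_subset[of F "{..<n}"] by auto
  from 0 have "\<not> psd A0" by (simp add: F pencil_at_def)
  then obtain v where v: "v \<bullet> (A0 *v v) < 0"
    using 0(3) by (auto simp: psd_def not_le)
  have "bil (pencil F A0 A) (const_vec v) (const_vec v) \<in> trunc_qmodule n (pencil F A0 A) 0"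
    by (intro trunc_qmodule_bil) (simp add: const_vec_def)
  hence "Const (- 1 / (v \<bullet> (A0 *v v))) * bil (pencil F A0 A) (const_vec v) (const_vec v)
      \<in> trunc_qmodule n (pencil F A0 A) 0"
    using v by (intro trunc_qmodule_Const_mult) (auto simp: divide_nonpos_neg)
  also have "bil (pencil F A0 A) (const_vec v) (const_vec v) = Const (v \<bullet> (A0 *v v))"
    by (simp add: bil_pencil_const_vec affine_poly_def F)
  finally have "Const (- 1 / (v \<bullet> (A0 *v v)) * (v \<bullet> (A0 *v v))) \<in> trunc_qmodule n (pencil F A0 A) 0"
    by (simp only: Const_mult)
  moreover have "- 1 / (v \<bullet> (A0 *v v)) * (v \<bullet> (A0 *v v)) = - 1" using v by simp
  ultimately show ?case by (simp add: F Const_minus)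
next
  case (Suc d)
  note F = \<open>F \<subseteq> {..<n}\<close> and sym = Suc.prems(2,3) and infeasible = Suc.prems(4)
  let ?L = "pencil F A0 A"
  define k where "k = 2 ^ d - (1 :: nat)"
  have bound: "2 ^ card F - 1 = k + k + 1"
  proof -
    have "2 ^ card F = 2 * (2 ^ d :: nat)" and "(1 :: nat) \<le> 2 ^ d"
      by (simp_all flip: Suc.hyps(2))
    thus ?thesis unfolding k_def by linarith
  qed
  show ?case
  proof (cases "- 1 \<in> trunc_qmodule n ?L 0")
    case True
    thus ?thesis using trunc_qmodule_mono[OF le0] by blast
  next
    case False
    then obtain c b where
      2: "c \<noteq> 0 \<or> (\<exists>i\<in>F. b i \<noteq> 0)" "- (affine_poly F c b)\<^sup>2 \<in> trunc_qmodule n ?L 1"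
      using infeasible_pencil_dichotomy[of F n A0 A, OF F sym infeasible] by blast
    show ?thesis
    proof (cases "\<exists>j\<in>F. b j \<noteq> 0")
      case False
      \<comment> \<open>Degree one is within the bound here, as at least one variable is present.\<close>
      hence "affine_poly F c b = Const c" and "c \<noteq> 0" using 2(1) by (auto intro: affine_poly_const)
      with 2(2) have "Const (1 / c\<^sup>2) * - (Const c)\<^sup>2 \<in> trunc_qmodule n ?L 1"
        by (intro trunc_qmodule_Const_mult) auto
      moreover have "Const (1 / c\<^sup>2) * - (Const c)\<^sup>2 = - 1"
        using \<open>c \<noteq> 0\<close> by (simp add: power2_eq_square flip: Const_mult)
      ultimately show ?thesis
        unfolding bound using trunc_qmodule_mono[of 1 "k + k + 1" n ?L] by auto
    next
      case True
      then obtain j where j: "j \<in> F" "b j \<noteq> 0" by blast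
      define G where "G = F - {j}"
      have G: "finite G" "j \<notin> G" "F = insert j G" "card G = d" "G \<subseteq> {..<n}"
        using j F finite_subset[of F "{..<n}"] Suc.hyps(2) by (auto simp: G_def)
      \<comment> \<open>Substitute for variable \<open>j\<close> its value on the zero set of the affine polynomial.\<close>
      define A0' where "A0' = A0 - (c / b j) *\<^sub>R A j"
      define A' where "A' = (\<lambda>i. A i - (b i / b j) *\<^sub>R A j)"
      let ?l = "affine_poly F c b"
      define D where "D = (- 1 / b j) *\<^sub>R A j"
      have sub: "pencil G A0' A' $ r $ s = ?L $ r $ s + ?l * Const (D $ r $ s)" for r s
      proof -
        let ?d = "D $ r $ s"
        have "?L $ r $ s + ?l * Const ?d =
          affine_poly F (A0 $ r $ s + ?d * c) (\<lambda>i. A i $ r $ s + ?d * b i)"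
          unfolding mult.commute[of ?l] affine_poly_Const_mult
          by (simp add: pencil_def affine_poly_add)
        also have "\<dots> = affine_poly F (A0' $ r $ s) (\<lambda>i. A' i $ r $ s)"
          by (intro affine_poly_cong) (simp_all add: A0'_def A'_def D_def)
        also have "\<dots> = affine_poly G (A0' $ r $ s) (\<lambda>i. A' i $ r $ s)"
          using j(2) G(1,2) by (simp add: G(3) affine_poly_def A'_def)
        finally show ?thesis by (simp add: pencil_def)
      qed
      have transpose_sub: "transpose (B - t *\<^sub>R C) = transpose B - t *\<^sub>R transpose C"
        for B C :: "real ^ 'a ^ 'a" and t
        by (simp add: transpose_def vec_eq_iff)
      have "- 1 \<in> trunc_qmodule n (pencil G A0' A') (2 ^ card G - 1)"
      proof (rule Suc.hyps(1))
        show "transpose A0' = A0'" using sym j by (simp add: A0'_def transpose_sub)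
        show "transpose (A' i) = A' i" if "i \<in> G" for i
          using sym j that G(3) by (simp add: A'_def transpose_sub)
        show "\<not> psd (pencil_at G A0' A' x)" for x
        proof -
          \<comment> \<open>The value of variable \<open>j\<close> at which the affine polynomial vanishes.\<close>
          define t where "t = - (c / b j) - (\<Sum>i\<in>G. x i * (b i / b j))"
          have "(\<Sum>i\<in>G. (x(j := t)) i *\<^sub>R A i) = (\<Sum>i\<in>G. x i *\<^sub>R A i)"
            using G(2) by (intro sum.cong) auto
          hence "pencil_at F A0 A (x(j := t)) = A0 + t *\<^sub>R A j + (\<Sum>i\<in>G. x i *\<^sub>R A i)"
            using G(1,2) by (simp add: pencil_at_def G(3))
          also have "\<dots> = pencil_at G A0' A' x"
            by (simp add: pencil_at_def A0'_def A'_def t_def scaleR_right_diff_distrib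
                sum_subtractf scaleR_diff_left scaleR_sum_left)
          finally show ?thesis using infeasible[of "x(j := t)"] by simp
        qed
      qed (use G in auto)
      hence "- 1 \<in> trunc_qmodule n (pencil G A0' A') k" by (simp add: G(4) k_def)
      from trunc_qmodule_perturb[OF this sub] obtain m q where
        mq: "m \<in> trunc_qmodule n ?L k" "q \<in> polys n (k + k)" "- 1 = m + ?l * q"
        by blast
      show ?thesis
        unfolding bound
        by (rule minus_one_from_null_poly[OF mq affine_poly_in_polys[OF F order_refl] 2(2)])
    qed
  qed
qed

theorem theorem2p3p1:
  fixes n :: nat and L :: "rpoly ^ 'm ^ 'm"
  assumes "linear_pencil n L"
    and "feasible_set n L = {}"
  shows "- 1 \<in> trunc_qmodule n L (2 ^ n - 1)"
proof -
  obtain A0 :: "real ^ 'm ^ 'm" and A :: "nat \<Rightarrow> real ^ 'm ^ 'm" where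
    sym: "transpose A0 = A0" "\<forall>i<n. transpose (A i) = A i" and
    "L = (\<chi> j k. Const (A0 $ j $ k) + (\<Sum>i<n. Var i * Const (A i $ j $ k)))"
    using assms(1) unfolding linear_pencil_def by (elim exE conjE)
  hence L: "L = pencil {..<n} A0 A" by (simp add: pencil_def affine_poly_def)
  have "\<not> psd (pencil_at {..<n} A0 A x)" for x
  proof
    assume psd: "psd (pencil_at {..<n} A0 A x)"
    \<comment> \<open>Feasible points are extensional, so the values beyond the variables are reset.\<close>
    define y where "y = restrict x {..<n}"
    have "map_matrix (eval_poly y) L = pencil_at {..<n} A0 A x"
      by (simp add: L map_matrix_def pencil_def pencil_at_def eval_affine_poly vec_eq_iff y_def)
    hence "y \<in> feasible_set n L"
      using psd by (simp add: feasible_set_def y_def)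
    thus False using assms(2) by simp
  qed
  from minus_one_in_trunc_qmodule_pencil[of "{..<n}" n A0 A, OF _ _ _ this] sym
  show ?thesis by (simp add: L)
qed

end
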